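(* Let $f:[0,1]\to\mathbb{R}$, and let $\mathcal{F}:[0,1]\to\mathbb{R}$, $\mathcal{F}(x):=\frac{f(x)+f(1-x)}{2}$, be its symmetrization. (1) If $\mathcal{F}$ is concave on $[0,1]$ and $f(0)\geq f\big(\tfrac12\big)$, then $L_n(f)$ is decreasing and $R_n(f)$ is increasing in $n$. (2) If $\mathcal{F}$ is concave on $[0,1]$ and $f(1)\geq f\big(\tfrac12\big)$, then $L_n(f)$ is increasing and $R_n(f)$ is decreasing in $n$. (3) If $\mathcal{F}$ is convex on $[0,1]$ and $f(1)\leq f\big(\tfrac12\big)$, then $L_n(f)$ is decreasing and $R_n(f)$ is increasing in $n$. (4) If $\mathcal{F}$ is convex on $[0,1]$ and $f(0)\leq f\big(\tfrac12\big)$, then $L_n(f)$ is increasing and $R_n(f)$ is decreasing in $n$.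
   Context: For $f:[0,1]\to\mathbb{R}$ and an integer $n\ge 1$, the left and right Riemann sums of $f$ are $L_n(f):=\frac1n\sum_{k=0}^{n-1}f\big(\tfrac kn\big)$ and $R_n(f):=\frac1n\sum_{k=1}^{n}f\big(\tfrac kn\big)$. "Increasing" and "decreasing" (in $n$) are meant in the weak (non-strict) sense, over integers $n\geq 1$. *)

theory Defs
  imports "HOL-Analysis.Analysis"
begin

text \<open>
  A function on the interval [0,1] is represented by a total function on the reals; the
  definitions below, when used with \<open>n \<ge> 1\<close> and \<open>x\<close> in [0,1], only evaluate it
  at points of [0,1].
\<close>

definition left_riemann_sum :: "(real \<Rightarrow> real) \<Rightarrow> nat \<Rightarrow> real" where
  "left_riemann_sum f n = (1 / real n) * (\<Sum>k = 0..<n. f (real k / real n))"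

definition right_riemann_sum :: "(real \<Rightarrow> real) \<Rightarrow> nat \<Rightarrow> real" where
  "right_riemann_sum f n = (1 / real n) * (\<Sum>k = 1..n. f (real k / real n))"

definition symmetrization :: "(real \<Rightarrow> real) \<Rightarrow> real \<Rightarrow> real" where
  "symmetrization f x = (f x + f (1 - x)) / 2"

end

theory Submission
  imports Defs
begin

text \<open>
  Write \<open>F\<close> for the symmetrization of \<open>f\<close>. Pairing \<open>k\<close> with \<open>n - k\<close> gives
  \<open>L\<^sub>n f = L\<^sub>n F + (f 0 - f 1) / (2 n)\<close>: the sums of \<open>f\<close> and \<open>F\<close> differ by an explicit
  multiple of \<open>1 / n\<close>, whose increments are multiples of \<open>1 / (n (n + 1))\<close>. For concave \<open>F\<close>,
  the heart of the proof is that the increments of \<open>L\<^sub>n F\<close> are no larger than this scale: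
  \<open>n (n + 1) \<bar>L\<^bsub>n+1\<^esub> F - L\<^sub>n F\<bar> \<le> F (1/2) - F 0\<close>
  (\<open>concave_left_riemann_sum_increment\<close>). As \<open>F 0 = (f 0 + f 1) / 2\<close> and \<open>F (1/2) = f (1/2)\<close>,
  the hypothesis \<open>f 0 \<ge> f (1/2)\<close> says exactly that \<open>(f 0 - f 1) / 2 \<ge> F (1/2) - F 0\<close>, so
  the correction term decides the sign of the increment of \<open>L\<^sub>n f\<close>; likewise
  \<open>f 1 \<ge> f (1/2)\<close> says that \<open>(f 1 - f 0) / 2 \<ge> F (1/2) - F 0\<close>.

  The increment bound is obtained by interpolating between the two grids. Each point of the grid
  of mesh \<open>1 / (n + 1)\<close> is a convex combination of two neighbours in the grid of mesh \<open>1 / n\<close>,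
  and conversely. Concavity gives an inequality at every grid point; on summation the
  weights at each interior point add up to a constant, and after normalising \<open>F\<close> to vanish at
  \<open>0\<close> and \<open>1\<close> this compares \<open>L\<^sub>n F\<close> with \<open>L\<^bsub>n+1\<^esub> F\<close> up to the factors \<open>1 - 1 / n\<^sup>2\<close> and
  \<open>1 - 1 / (n + 1)\<^sup>2\<close>. The remaining error is
  controlled by the maximum of \<open>F\<close>, which concavity and symmetry place at \<open>1/2\<close>.

  The reflection \<open>x \<mapsto> 1 - x\<close> exchanges left and right sums, and \<open>f \<mapsto> - f\<close> exchanges
  concave and convex, so all four assertions reduce to left sums in the concave case.
\<close>

section \<open>Comparing the sums over two consecutive grids\<close>

text \<open>
  The point \<open>k / (n + 1)\<close> is the convex combination of \<open>(k - 1) / n\<close> and \<open>k / n\<close> with weights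
  \<open>k / (n + 1)\<close> and \<open>(n + 1 - k) / (n + 1)\<close>. Multiplied by \<open>n + 1\<close> and summed over \<open>k\<close>, the
  weights of an interior point \<open>j / n\<close> add up to \<open>(j + 1) + (n + 1 - j) = n + 2\<close>.
\<close>

lemma concave_finer_grid_sum:
  fixes g :: "real \<Rightarrow> real" and n :: nat
  assumes conc: "concave_on {0..1} g" and "g 0 = 0" "g 1 = 0" and "n \<ge> 1"
  shows "real (n + 2) * (\<Sum>k<n. g (k / n)) \<le> real (n + 1) * (\<Sum>k<n+1. g (k / real (n + 1)))"
proof -
  (* For k = 0 the truncated k - 1 carries weight 0. *)
  have ineq: "real k * g (real (k - 1) / n) + (real (n + 1) - k) * g (k / n)
          \<le> real (n + 1) * g (k / real (n + 1))" if "k < n + 1" for k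
  proof (cases "k = 0")
    case True
    then show ?thesis using assms by simp
  next
    case False
    define t where "t = real k / real (n + 1)"
    have "(1 - t) * g (k / n) + t * g (real (k - 1) / n)
          \<le> g ((1 - t) *\<^sub>R (k / n) + t *\<^sub>R (real (k - 1) / n))"
      by (rule concave_onD[OF conc]) (use that \<open>n \<ge> 1\<close> in \<open>auto simp: t_def divide_simps\<close>)
    also have "(1 - t) *\<^sub>R (k / n) + t *\<^sub>R (real (k - 1) / n)
        = ((1 - t) * k + t * real (k - 1)) / n"
      by (simp only: real_scaleR_def times_divide_eq_right add_divide_distrib)
    also have "(1 - t) * k + t * real (k - 1) = real k - t"
      using False by (simp add: of_nat_diff algebra_simps)
    also have "(real k - t) / n = k / real (n + 1)"
      using \<open>n \<ge> 1\<close> unfolding t_def by (simp add: divide_simps) (simp add: algebra_simps)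
    finally have "real (n + 1) * ((1 - t) * g (k / n) + t * g (real (k - 1) / n))
          \<le> real (n + 1) * g (k / real (n + 1))"
      by (intro mult_left_mono) auto
    moreover have "real (n + 1) * t = k" "real (n + 1) * (1 - t) = real (n + 1) - k"
      by (simp_all add: t_def field_simps)
    ultimately show ?thesis
      by (simp only: distrib_left mult.assoc[symmetric] add.commute)
  qed
  have "real (n + 2) * (\<Sum>k<n. g (k / n))
      = (\<Sum>k<n. real (Suc k) * g (k / n)) + (\<Sum>k<n. (real (n + 1) - k) * g (k / n))"
    by (simp add: sum_distrib_left sum.distrib[symmetric] algebra_simps)
  also have "(\<Sum>k<n. real (Suc k) * g (k / n)) = (\<Sum>k<n+1. real k * g (real (k - 1) / n))"
    by (simp add: sum.lessThan_Suc_shift del: sum.lessThan_Suc of_nat_Suc)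
  also have "(\<Sum>k<n. (real (n + 1) - k) * g (k / n)) = (\<Sum>k<n+1. (real (n + 1) - k) * g (k / n))"
    using assms by simp
  also have "(\<Sum>k<n+1. real k * g (real (k - 1) / n)) + \<dots>
      \<le> real (n + 1) * (\<Sum>k<n+1. g (k / real (n + 1)))"
    unfolding sum.distrib[symmetric] sum_distrib_left by (intro sum_mono ineq) auto
  finally show ?thesis .
qed

text \<open>
  The point \<open>k / n\<close> is the convex combination of \<open>k / (n + 1)\<close> and \<open>(k + 1) / (n + 1)\<close> with
  weights \<open>(n - k) / n\<close> and \<open>k / n\<close>. Multiplied by \<open>n\<close> and summed over \<open>k\<close>, the weights of an
  interior point \<open>j / (n + 1)\<close> add up to \<open>(n - j) + (j - 1) = n - 1\<close>.
\<close>

lemma concave_coarser_grid_sum: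
  fixes g :: "real \<Rightarrow> real" and n :: nat
  assumes conc: "concave_on {0..1} g" and "g 0 = 0" "g 1 = 0" and "n \<ge> 1"
  shows "(real n - 1) * (\<Sum>k<n+1. g (k / real (n + 1))) \<le> real n * (\<Sum>k<n. g (k / n))"
proof -
  define G where "G k = g (real k / real (n + 1))" for k
  have ineq: "(real n - k) * G k + real k * G (Suc k) \<le> real n * g (k / n)"
    if "k < n + 1" for k
  proof -
    define t where "t = real k / n"
    have "(1 - t) * G k + t * G (Suc k)
          \<le> g ((1 - t) *\<^sub>R (k / real (n + 1)) + t *\<^sub>R (Suc k / real (n + 1)))"
      unfolding G_def
      by (rule concave_onD[OF conc]) (use that \<open>n \<ge> 1\<close> in \<open>auto simp: t_def divide_simps\<close>)
    also have "(1 - t) *\<^sub>R (k / real (n + 1)) + t *\<^sub>R (Suc k / real (n + 1))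
        = ((1 - t) * k + t * Suc k) / real (n + 1)"
      by (simp only: real_scaleR_def times_divide_eq_right add_divide_distrib)
    also have "(1 - t) * k + t * Suc k = real k + t"
      by (simp add: algebra_simps)
    also have "(real k + t) / real (n + 1) = k / n"
      using \<open>n \<ge> 1\<close> unfolding t_def by (simp add: divide_simps) (simp add: algebra_simps)
    finally have "real n * ((1 - t) * G k + t * G (Suc k)) \<le> real n * g (k / n)"
      by (intro mult_left_mono) auto
    moreover have "real n * t = k" "real n * (1 - t) = real n - k"
      using \<open>n \<ge> 1\<close> by (simp_all add: t_def field_simps)
    ultimately show ?thesis
      by (simp only: distrib_left mult.assoc[symmetric])
  qed
  have ends: "G 0 = 0" "G (n + 1) = 0"
    using assms by (simp_all add: G_def del: of_nat_add of_nat_Suc)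
  have "(real n - 1) * (\<Sum>k<n+1. G k)
      = (\<Sum>k<n+1. (real n - k) * G k) + (\<Sum>k<n+1. (real k - 1) * G k)"
    by (simp only: sum_distrib_left sum.distrib[symmetric]) (simp add: algebra_simps)
  also have "(\<Sum>k<n+1. (real k - 1) * G k) = (\<Sum>k<Suc (n+1). (real k - 1) * G k)"
    by (simp only: sum.lessThan_Suc ends)
  also have "\<dots> = (\<Sum>k<n+1. real k * G (Suc k))"
    by (simp only: sum.lessThan_Suc_shift ends) simp
  also have "(\<Sum>k<n+1. (real n - k) * G k) + \<dots> \<le> (\<Sum>k<n+1. real n * g (k / n))"
    unfolding sum.distrib[symmetric] by (intro sum_mono ineq) auto
  also have "\<dots> = real n * (\<Sum>k<n. g (k / n))"
    using assms by (simp add: sum_distrib_left)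
  finally show ?thesis unfolding G_def .
qed

text \<open>
  With \<open>S n\<close> the unnormalised sum of \<open>g = F - F 0\<close>, the two comparisons bound
  \<open>n S (n + 1) - (n + 1) S n\<close> from below by \<open>- S n / (n + 1)\<close> and from above by \<open>S (n + 1) / n\<close>.
  Concavity and symmetry put the maximum of \<open>g\<close> at \<open>1/2\<close>, so both quotients are at most \<open>g (1/2)\<close>.
\<close>

lemma concave_left_riemann_sum_increment:
  fixes F :: "real \<Rightarrow> real"
  assumes conc: "concave_on {0..1} F" and sym: "\<And>x. F (1 - x) = F x" and "n \<ge> 1"
  shows "\<bar>left_riemann_sum F (Suc n) - left_riemann_sum F n\<bar>
           \<le> (F (1 / 2) - F 0) / (real n * real (n + 1))"
proof -
  define g where "g x = F x - F 0" for x
  define S where "S m = (\<Sum>k<m. g (real k / real m))" for m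
  have conc_g: "concave_on {0..1} g"
    unfolding g_def by (intro concave_on_diff conc) (simp add: convex_on_const)
  have g0: "g 0 = 0" "g 1 = 0"
    using sym[of 0] by (simp_all add: g_def)
  have gmax: "g x \<le> g (1 / 2)" if "0 \<le> x" "x \<le> 1" for x
  proof -
    have "(1 - 1/2) * g x + (1/2) * g (1 - x) \<le> g ((1 - 1/2) *\<^sub>R x + (1/2) *\<^sub>R (1 - x))"
      by (rule concave_onD[OF conc_g]) (use that in auto)
    then show ?thesis using sym[of x] by (simp add: g_def field_simps)
  qed
  (* The term at 0 vanishes, which saves one summand; the upper bound below has no slack. *)
  have S_le: "S (Suc m) \<le> real m * g (1 / 2)" for m
  proof -
    have "S (Suc m) = (\<Sum>k<m. g (real (Suc k) / real (Suc m)))"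
      unfolding S_def sum.lessThan_Suc_shift using g0 by simp
    also have "\<dots> \<le> (\<Sum>k<m. g (1 / 2))"
      by (intro sum_mono gmax) auto
    finally show ?thesis by simp
  qed
  have L: "left_riemann_sum F m = S m / m + F 0" if "m \<ge> 1" for m
    using that by (simp add: left_riemann_sum_def S_def g_def sum_subtractf atLeast0LessThan field_simps)
  have M: "g (1 / 2) \<ge> 0" using gmax[of 0] g0 by simp
  define d where "d = real n * S (n + 1) - real (n + 1) * S n"
  have "real (n + 2) * S n \<le> real (n + 1) * S (n + 1)"
    unfolding S_def by (rule concave_finer_grid_sum[OF conc_g g0 \<open>n \<ge> 1\<close>])
  then have "real n * (real (n + 2) * S n) \<le> real n * (real (n + 1) * S (n + 1))"
    by (intro mult_left_mono) auto
  then have "- S n \<le> real (n + 1) * d"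
    by (simp add: d_def algebra_simps)
  moreover have "S n \<le> real (n + 1) * g (1 / 2)"
  proof -
    have "S n \<le> real (n - 1) * g (1 / 2)"
      using S_le[of "n - 1"] \<open>n \<ge> 1\<close> by simp
    also have "\<dots> \<le> real (n + 1) * g (1 / 2)"
      using M by (intro mult_right_mono) auto
    finally show ?thesis .
  qed
  ultimately have "real (n + 1) * (- g (1 / 2)) \<le> real (n + 1) * d"
    by simp
  then have lower: "- g (1 / 2) \<le> d"
    by (subst (asm) mult_le_cancel_left_pos) auto
  have "(real n - 1) * S (n + 1) \<le> real n * S n"
    unfolding S_def by (rule concave_coarser_grid_sum[OF conc_g g0 \<open>n \<ge> 1\<close>])
  then have "real (n + 1) * ((real n - 1) * S (n + 1)) \<le> real (n + 1) * (real n * S n)"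
    by (intro mult_left_mono) auto
  then have "real n * d \<le> S (n + 1)"
    by (simp add: d_def algebra_simps)
  also have "S (n + 1) \<le> real n * g (1 / 2)"
    using S_le[of n] by simp
  finally have upper: "d \<le> g (1 / 2)"
    using \<open>n \<ge> 1\<close> by simp
  have "left_riemann_sum F (Suc n) - left_riemann_sum F n = d / (real n * real (n + 1))"
    using \<open>n \<ge> 1\<close> by (simp add: L d_def field_simps)
  moreover have "\<bar>d\<bar> \<le> F (1 / 2) - F 0"
    using lower upper by (simp add: g_def)
  ultimately show ?thesis
    by (simp add: abs_mult divide_right_mono)
qed

section \<open>From the symmetrization back to the function\<close>

lemma left_riemann_sum_eq_symmetrization:
  assumes "n \<ge> 1"
  shows "left_riemann_sum f n
           = left_riemann_sum (symmetrization f) n + (f 0 - f 1) / 2 / real n"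
proof -
  define S where "S = (\<Sum>k<n. f (real k / real n))"
  have "(\<Sum>k<n. f (1 - real k / real n)) = (\<Sum>k<n. f (real (Suc k) / real n))"
  proof (subst sum.nat_diff_reindex[symmetric], intro sum.cong refl arg_cong[of _ _ f])
    fix k assume "k \<in> {..<n}"
    then show "1 - real (n - Suc k) / real n = real (Suc k) / real n"
      by (simp add: of_nat_diff field_simps)
  qed
  also have "\<dots> + f 0 = S + f 1"
    using sum.lessThan_Suc_shift[of "\<lambda>k. f (real k / real n)" n] assms by (simp add: S_def)
  finally have "(\<Sum>k<n. f (1 - real k / real n)) = S + f 1 - f 0" by simp
  then have "(\<Sum>k<n. symmetrization f (real k / real n)) = S + (f 1 - f 0) / 2"
    by (simp add: symmetrization_def sum.distrib sum_divide_distrib[symmetric] S_def[symmetric]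
        field_simps)
  then have "left_riemann_sum (symmetrization f) n = (S + (f 1 - f 0) / 2) / n"
    by (simp add: left_riemann_sum_def atLeast0LessThan)
  moreover have "left_riemann_sum f n = S / n"
    by (simp add: left_riemann_sum_def atLeast0LessThan S_def)
  ultimately show ?thesis
    using assms by (simp add: field_simps)
qed

lemma right_riemann_sum_eq_left_reflected:
  "right_riemann_sum f = left_riemann_sum (\<lambda>x. f (1 - x))"
proof
  fix n
  have "(\<Sum>k = 1..n. f (real k / real n)) = (\<Sum>k<n. f (real (Suc k) / real n))"
    by (simp add: sum.atLeast1_atMost_eq)
  also have "\<dots> = (\<Sum>k<n. f (1 - real k / real n))"
  proof (subst sum.nat_diff_reindex[symmetric], intro sum.cong refl arg_cong[of _ _ f])
    fix k assume "k \<in> {..<n}"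
    then show "real (Suc (n - Suc k)) / real n = 1 - real k / real n"
      by (simp add: of_nat_diff field_simps)
  qed
  finally show "right_riemann_sum f n = left_riemann_sum (\<lambda>x. f (1 - x)) n"
    by (simp add: right_riemann_sum_def left_riemann_sum_def atLeast0LessThan)
qed

lemma symmetrization_reflected: "symmetrization (\<lambda>x. f (1 - x)) = symmetrization f"
  by (simp add: symmetrization_def fun_eq_iff)

lemma symmetrization_uminus: "symmetrization (\<lambda>x. - f x) = (\<lambda>x. - symmetrization f x)"
  by (simp add: symmetrization_def fun_eq_iff field_simps)

lemma left_riemann_sum_uminus: "left_riemann_sum (\<lambda>x. - f x) = (\<lambda>n. - left_riemann_sum f n)"
  by (simp add: left_riemann_sum_def fun_eq_iff sum_negf)

lemma mono_on_atLeast_1I: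
  fixes a :: "nat \<Rightarrow> real"
  assumes step: "\<And>n. n \<ge> 1 \<Longrightarrow> a n \<le> a (Suc n)"
  shows "mono_on {1..} a"
proof (rule mono_onI)
  fix m n :: nat
  assume "m \<in> {1..}" "m \<le> n"
  from this(2,1) show "a m \<le> a n"
    by (induction rule: dec_induct) (auto intro: order_trans[OF _ step])
qed

lemma mono_on_uminus_iff_antimono_on:
  fixes a :: "'a :: order \<Rightarrow> real"
  shows "mono_on A (\<lambda>n. - a n) \<longleftrightarrow> antimono_on A a"
  by (simp add: monotone_on_def)

section \<open>Monotonicity of the left sums\<close>

text \<open>
  The correction term \<open>(f 0 - f 1) / (2 n)\<close> changes from \<open>n\<close> to \<open>n + 1\<close> by
  \<open>- (f 0 - f 1) / 2 / (n (n + 1))\<close>, and the symmetrized sums move by at most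
  \<open>(f (1/2) - (f 0 + f 1) / 2) / (n (n + 1))\<close> in either direction. The sum of the two changes
  therefore has numerator at most \<open>f (1/2) - f 0\<close> and at least \<open>f 1 - f (1/2)\<close>.
\<close>

lemma concave_symmetrization_increment_bounds:
  assumes conc: "concave_on {0..1} (symmetrization f)" and "n \<ge> 1"
  shows "left_riemann_sum f (Suc n) - left_riemann_sum f n
           \<le> (f (1 / 2) - f 0) / (real n * real (n + 1))" (is ?upper)
    and "(f 1 - f (1 / 2)) / (real n * real (n + 1))
           \<le> left_riemann_sum f (Suc n) - left_riemann_sum f n" (is ?lower)
proof -
  let ?F = "symmetrization f" and ?N = "real n * real (n + 1)"
  have "\<bar>left_riemann_sum ?F (Suc n) - left_riemann_sum ?F n\<bar> \<le> (?F (1 / 2) - ?F 0) / ?N"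
    by (rule concave_left_riemann_sum_increment[OF conc _ \<open>n \<ge> 1\<close>])
      (simp add: symmetrization_def add.commute)
  also have "?F (1 / 2) - ?F 0 = f (1 / 2) - (f 0 + f 1) / 2"
    by (simp add: symmetrization_def)
  finally have main: "\<bar>left_riemann_sum ?F (Suc n) - left_riemann_sum ?F n\<bar>
      \<le> (f (1 / 2) - (f 0 + f 1) / 2) / ?N" .
  have "left_riemann_sum f (Suc n) - left_riemann_sum f n
      = left_riemann_sum ?F (Suc n) - left_riemann_sum ?F n
        + ((f 0 - f 1) / 2 / real (Suc n) - (f 0 - f 1) / 2 / real n)"
    using \<open>n \<ge> 1\<close> by (simp add: left_riemann_sum_eq_symmetrization[of _ f])
  also have "c / real (Suc n) - c / real n = - c / ?N" for c
    using \<open>n \<ge> 1\<close> by (simp add: divide_simps) (simp add: algebra_simps)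
  finally have split: "left_riemann_sum f (Suc n) - left_riemann_sum f n
      = left_riemann_sum ?F (Suc n) - left_riemann_sum ?F n - (f 0 - f 1) / 2 / ?N"
    by simp
  have "f (1 / 2) - f 0 = f (1 / 2) - (f 0 + f 1) / 2 - (f 0 - f 1) / 2"
    by (simp add: field_simps)
  then have "(f (1 / 2) - f 0) / ?N = (f (1 / 2) - (f 0 + f 1) / 2) / ?N - (f 0 - f 1) / 2 / ?N"
    by (simp only: diff_divide_distrib[symmetric])
  then show ?upper using main split by linarith
  have "f 1 - f (1 / 2) = - (f (1 / 2) - (f 0 + f 1) / 2) - (f 0 - f 1) / 2"
    by (simp add: field_simps)
  then have "(f 1 - f (1 / 2)) / ?N = - ((f (1 / 2) - (f 0 + f 1) / 2) / ?N) - (f 0 - f 1) / 2 / ?N"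
    by (simp only: diff_divide_distrib[symmetric] minus_divide_left)
  then show ?lower using main split by linarith
qed

lemma concave_symmetrization_left_riemann_sum_monotone:
  assumes conc: "concave_on {0..1} (symmetrization f)"
  shows "f 0 \<ge> f (1 / 2) \<Longrightarrow> antimono_on {1..} (left_riemann_sum f)"
    and "f 1 \<ge> f (1 / 2) \<Longrightarrow> mono_on {1..} (left_riemann_sum f)"
proof -
  assume "f 0 \<ge> f (1 / 2)"
  then have "(f (1 / 2) - f 0) / (real n * real (n + 1)) \<le> 0" for n
    by (intro divide_nonpos_nonneg) auto
  then have "mono_on {1..} (\<lambda>n. - left_riemann_sum f n)"
    using concave_symmetrization_increment_bounds(1)[OF conc]
    by (intro mono_on_atLeast_1I) (smt (verit))
  then show "antimono_on {1..} (left_riemann_sum f)"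
    by (simp only: mono_on_uminus_iff_antimono_on)
next
  assume "f 1 \<ge> f (1 / 2)"
  then have "(f 1 - f (1 / 2)) / (real n * real (n + 1)) \<ge> 0" for n
    by (intro divide_nonneg_nonneg) auto
  then show "mono_on {1..} (left_riemann_sum f)"
    using concave_symmetrization_increment_bounds(2)[OF conc]
    by (intro mono_on_atLeast_1I) (smt (verit))
qed

lemma convex_symmetrization_left_riemann_sum_monotone:
  assumes conv: "convex_on {0..1} (symmetrization f)"
  shows "f 0 \<le> f (1 / 2) \<Longrightarrow> mono_on {1..} (left_riemann_sum f)"
    and "f 1 \<le> f (1 / 2) \<Longrightarrow> antimono_on {1..} (left_riemann_sum f)"
proof -
  have "concave_on {0..1} (symmetrization (\<lambda>x. - f x))"
    using conv by (simp add: concave_on_def symmetrization_uminus)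
  note * = concave_symmetrization_left_riemann_sum_monotone[OF this]
  show "f 0 \<le> f (1 / 2) \<Longrightarrow> mono_on {1..} (left_riemann_sum f)"
    using *(1) by (simp add: left_riemann_sum_uminus mono_on_uminus_iff_antimono_on[symmetric])
  show "f 1 \<le> f (1 / 2) \<Longrightarrow> antimono_on {1..} (left_riemann_sum f)"
    using *(2) by (simp add: left_riemann_sum_uminus mono_on_uminus_iff_antimono_on)
qed

theorem theorem2p4:
  fixes f :: "real \<Rightarrow> real"
  shows "(concave_on {0..1} (symmetrization f) \<and> f 0 \<ge> f (1 / 2) \<longrightarrow>
            antimono_on {1..} (left_riemann_sum f) \<and> mono_on {1..} (right_riemann_sum f))
       \<and> (concave_on {0..1} (symmetrization f) \<and> f 1 \<ge> f (1 / 2) \<longrightarrow>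
            mono_on {1..} (left_riemann_sum f) \<and> antimono_on {1..} (right_riemann_sum f))
       \<and> (convex_on {0..1} (symmetrization f) \<and> f 1 \<le> f (1 / 2) \<longrightarrow>
            antimono_on {1..} (left_riemann_sum f) \<and> mono_on {1..} (right_riemann_sum f))
       \<and> (convex_on {0..1} (symmetrization f) \<and> f 0 \<le> f (1 / 2) \<longrightarrow>
            mono_on {1..} (left_riemann_sum f) \<and> antimono_on {1..} (right_riemann_sum f))"
  using concave_symmetrization_left_riemann_sum_monotone[of f]
    convex_symmetrization_left_riemann_sum_monotone[of f]
    concave_symmetrization_left_riemann_sum_monotone[of "\<lambda>x. f (1 - x)"]
    convex_symmetrization_left_riemann_sum_monotone[of "\<lambda>x. f (1 - x)"]
  unfolding right_riemann_sum_eq_left_reflected symmetrization_reflected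
  by simp

end
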